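(* Let $n\ge2$, let $E/K$ be a purely inseparable algebraic field extension of characteristic $p>0$ and let $F(\underline x)\in K[\underline x]=K[x_1,\dots,x_n]$. Assume that $F(\underline x)$ is not of the form $b\,G(\underline x)^p+c$ with $G(\underline x)\in E[\underline x]$ and $b,c\in K$. Then $F(\underline x)$ is indecomposable in $K[\underline x]$ if and only if it is indecomposable in $E[\underline x]$.
   Context: For an arbitrary field $L$ and $n\ge2$, a non-constant polynomial $F\in L[\underline x]$ is indecomposable in $L[\underline x]$ if it is not of the form $u(H(\underline x))$ with $H\in L[\underline x]$, $u\in L[t]$ and $\deg u\ge2$. *)

theory Defs
  imports
    "HOL-Library.Poly_Mapping"
    "HOL-Computational_Algebra.Computational_Algebra"
begin

text \<open>
  A field extension \<open>E/K\<close> is rendered as a type \<open>'a::field\<close> (the field \<open>E\<close>) together with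
  a subset \<open>K\<close> that is a subfield; \<open>E\<close> itself is \<open>UNIV\<close>.
\<close>

definition is_subfield :: "'a::field set \<Rightarrow> bool" where
  "is_subfield K \<longleftrightarrow>
     0 \<in> K \<and> 1 \<in> K \<and>
     (\<forall>x\<in>K. \<forall>y\<in>K. x + y \<in> K \<and> x * y \<in> K) \<and>
     (\<forall>x\<in>K. - x \<in> K \<and> inverse x \<in> K)"

text \<open>
  The standard definition for fields of characteristic \<open>p > 0\<close>: every element of the extension
  has some \<open>p\<close>-power-th power in \<open>K\<close>.  Such an extension is algebraic, an element \<open>a\<close> being a
  root of \<open>X ^ p ^ e - a ^ p ^ e\<close>.  Only meaningful when \<open>p\<close> is the characteristic and positive.
\<close>

definition purely_inseparable :: "nat \<Rightarrow> 'a::field set \<Rightarrow> bool" where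
  "purely_inseparable p K \<longleftrightarrow> (\<forall>a. \<exists>e. a ^ (p ^ e) \<in> K)"

text \<open>
  Multivariate polynomials are finitely supported maps from monomials (exponent vectors) to
  coefficients, with the convolution product of \<^theory>\<open>HOL-Library.Poly_Mapping\<close>.
  The variables \<open>x\<^sub>1, \<dots>, x\<^sub>n\<close> are those with index \<open>0, \<dots>, n - 1\<close>.
\<close>

type_synonym 'a mpoly = "(nat \<Rightarrow>\<^sub>0 nat) \<Rightarrow>\<^sub>0 'a"

definition mconst :: "'a::zero \<Rightarrow> 'a mpoly" where
  "mconst c = Poly_Mapping.single 0 c"

text \<open>The polynomial ring \<open>L[x\<^sub>1, \<dots>, x\<^sub>n]\<close>, as a subset of the polynomials over \<open>'a\<close>.\<close>

definition mpolys :: "'a::zero set \<Rightarrow> nat \<Rightarrow> 'a mpoly set" where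
  "mpolys L n = {P. (\<forall>m. Poly_Mapping.lookup P m \<in> L) \<and>
                    (\<forall>m \<in> Poly_Mapping.keys P. Poly_Mapping.keys m \<subseteq> {..<n})}"

text \<open>\<open>u(H)\<close>: evaluation at \<open>H\<close> of \<open>u\<close> with its coefficients regarded as constant polynomials.\<close>

definition mpoly_subst :: "'a::field poly \<Rightarrow> 'a mpoly \<Rightarrow> 'a mpoly" where
  "mpoly_subst u H = poly (map_poly mconst u) H"

definition indecomposable :: "'a::field set \<Rightarrow> nat \<Rightarrow> 'a mpoly \<Rightarrow> bool" where
  "indecomposable L n F \<longleftrightarrow>
     F \<in> mpolys L n \<and> F \<notin> range mconst \<and>
     \<not> (\<exists>H u. H \<in> mpolys L n \<and> (\<forall>i. Polynomial.coeff u i \<in> L) \<and>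
              Polynomial.degree u \<ge> 2 \<and> F = mpoly_subst u H)"

end

theory Submission
  imports Defs
begin

text \<open>
  A decomposition over \<open>K\<close> is one over \<open>E\<close>, so the point is to turn a decomposition \<open>F = u(H)\<close> over
  \<open>E\<close> into one over \<open>K\<close>.  Write \<open>u = v(X ^ q)\<close> with \<open>q\<close> a power of \<open>p\<close> and \<open>v' \<noteq> 0\<close>
  (\<open>separable_part\<close>), so that \<open>F = v(H ^ q)\<close>.  An affine change of variable makes the inner
  polynomial \<open>H ^ q\<close> monic, for a suitable order of its monomials, with constant term \<open>0\<close>.  The
  claim is that then both \<open>v\<close> and \<open>H ^ q\<close> have coefficients in \<open>K\<close>.  If \<open>v\<close> has degree at least \<open>2\<close>, this decomposes \<open>F\<close> over \<open>K\<close>.  If \<open>v\<close> is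
  linear, then \<open>q > 1\<close> and \<open>F = b H ^ q + c\<close> with \<open>b, c\<close> in \<open>K\<close>, a form that is excluded because
  \<open>H ^ q\<close> is a \<open>p\<close>-th power.

  The claim is a rigidity statement about derivations (\<open>decomposition_rigid\<close>).  A derivation \<open>D\<close>
  that kills the coefficients of \<open>v(h)\<close> satisfies \<open>0 = (D v)(h) + v'(h) D h\<close>, where \<open>D\<close> acts on
  coefficients.  As \<open>v' \<noteq> 0\<close>, comparing degrees shows that \<open>D h\<close> is constant once \<open>h\<close> is monic, and it
  is \<open>0\<close> because \<open>h\<close> has no constant term; hence \<open>D v = 0\<close> too.  For \<open>c ^ p \<in> M\<close>, \<open>c \<notin> M\<close>, the field
  \<open>M(c)\<close> carries the derivation \<open>d/dc\<close>, whose field of constants is exactly \<open>M\<close>, so coefficients in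
  \<open>M(c)\<close> lie in \<open>M\<close>.  Finitely many elements of a purely inseparable extension lie in a finite
  tower of such steps, which can be descended one at a time.

  The degree comparison is one about polynomials in one variable.  A Kronecker substitution
  \<open>x\<^sub>i \<mapsto> X ^ N ^ i\<close> that separates the monomials of \<open>H ^ q\<close> preserves compositions and the
  coefficients of \<open>H ^ q\<close>, and so reduces several variables to one.
\<close>

section \<open>Polynomials with coefficients in a subfield\<close>

lemma is_subfieldD:
  assumes "is_subfield K"
  shows "0 \<in> K" "1 \<in> K"
    and "x \<in> K \<Longrightarrow> y \<in> K \<Longrightarrow> x + y \<in> K"
    and "x \<in> K \<Longrightarrow> y \<in> K \<Longrightarrow> x * y \<in> K"
    and "x \<in> K \<Longrightarrow> - x \<in> K"
    and "x \<in> K \<Longrightarrow> inverse x \<in> K"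
    and "x \<in> K \<Longrightarrow> y \<in> K \<Longrightarrow> x - y \<in> K"
    and "x \<in> K \<Longrightarrow> y \<in> K \<Longrightarrow> x / y \<in> K"
    and "x \<in> K \<Longrightarrow> x ^ k \<in> K"
proof -
  show basic: "0 \<in> K" "1 \<in> K"
    "\<And>x y. x \<in> K \<Longrightarrow> y \<in> K \<Longrightarrow> x + y \<in> K"
    "\<And>x y. x \<in> K \<Longrightarrow> y \<in> K \<Longrightarrow> x * y \<in> K"
    "\<And>x. x \<in> K \<Longrightarrow> - x \<in> K" "\<And>x. x \<in> K \<Longrightarrow> inverse x \<in> K"
    using assms by (auto simp: is_subfield_def)
  show "x \<in> K \<Longrightarrow> y \<in> K \<Longrightarrow> x - y \<in> K"
    using basic(3)[of x "- y"] basic(5)[of y] by simp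
  show "x \<in> K \<Longrightarrow> y \<in> K \<Longrightarrow> x / y \<in> K"
    using basic(4)[of x "inverse y"] basic(6)[of y] by (simp add: divide_inverse)
  show "x \<in> K \<Longrightarrow> x ^ k \<in> K"
    by (induction k) (auto intro: basic)
qed

definition coeffs_in :: "'a::zero set \<Rightarrow> 'a poly set" where
  "coeffs_in K = {q. \<forall>i. Polynomial.coeff q i \<in> K}"

lemma coeffs_inI: "(\<And>i. Polynomial.coeff q i \<in> K) \<Longrightarrow> q \<in> coeffs_in K"
  by (simp add: coeffs_in_def)

lemma coeffs_inD: "q \<in> coeffs_in K \<Longrightarrow> Polynomial.coeff q i \<in> K"
  by (simp add: coeffs_in_def)

lemma coeffs_in_mono: "K \<subseteq> L \<Longrightarrow> coeffs_in K \<subseteq> coeffs_in L"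
  by (auto simp: coeffs_in_def)

lemma coeffs_in_pCons [simp]: "pCons a q \<in> coeffs_in K \<longleftrightarrow> a \<in> K \<and> q \<in> coeffs_in K"
proof
  assume q: "pCons a q \<in> coeffs_in K"
  show "a \<in> K \<and> q \<in> coeffs_in K"
    using coeffs_inD[OF q, of 0] coeffs_inD[OF q, of "Suc _"] by (auto intro: coeffs_inI)
qed (auto simp: coeffs_in_def coeff_pCons split: nat.splits)

context
  fixes K :: "'a::field set"
  assumes K: "is_subfield K"
begin

lemma coeffs_in_closed:
  shows "0 \<in> coeffs_in K"
    and "q \<in> coeffs_in K \<Longrightarrow> r \<in> coeffs_in K \<Longrightarrow> q + r \<in> coeffs_in K"
    and "q \<in> coeffs_in K \<Longrightarrow> r \<in> coeffs_in K \<Longrightarrow> q - r \<in> coeffs_in K"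
    and "q \<in> coeffs_in K \<Longrightarrow> r \<in> coeffs_in K \<Longrightarrow> q * r \<in> coeffs_in K"
    and "a \<in> K \<Longrightarrow> q \<in> coeffs_in K \<Longrightarrow> smult a q \<in> coeffs_in K"
    and "q \<in> coeffs_in K \<Longrightarrow> r \<in> coeffs_in K \<Longrightarrow> pcompose q r \<in> coeffs_in K"
    and "a \<in> K \<Longrightarrow> monom a k \<in> coeffs_in K"
  using is_subfieldD[OF K] coeff_mult_semiring_closed[of K] coeff_pcompose_semiring_closed[of K]
  by (auto simp: coeffs_in_def)

lemma coeffs_in_pderiv: "q \<in> coeffs_in K \<Longrightarrow> pderiv q \<in> coeffs_in K"
  by (induction q) (auto simp: pderiv_pCons intro!: coeffs_in_closed is_subfieldD[OF K])

text \<open>Long division only ever divides by the leading coefficient of the divisor.\<close>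

lemma coeffs_in_mod:
  assumes "g \<in> coeffs_in K" "f \<in> coeffs_in K"
  shows "f mod g \<in> coeffs_in K"
proof (cases "g = 0")
  case False
  show ?thesis
    using assms(2)
  proof (induction f)
    case (pCons a f)
    then have "pCons a (f mod g) \<in> coeffs_in K"
      by simp
    with assms(1) show ?case
      unfolding mod_pCons[OF False] Let_def
      by (intro coeffs_in_closed is_subfieldD[OF K] coeffs_inD)
  qed (simp add: coeffs_in_closed)
qed (use assms in simp)

end

section \<open>Derivations of a subfield and rigidity of decompositions\<close>

locale subfield_derivation =
  fixes L :: "'a::field set" and D :: "'a \<Rightarrow> 'a"
  assumes subfield_L: "is_subfield L"
    and D_add: "x \<in> L \<Longrightarrow> y \<in> L \<Longrightarrow> D (x + y) = D x + D y"
    and D_mult: "x \<in> L \<Longrightarrow> y \<in> L \<Longrightarrow> D (x * y) = D x * y + x * D y"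
begin

lemma D_0 [simp]: "D 0 = 0"
proof -
  have "D 0 = D 0 + D 0"
    using D_add[of 0 0] is_subfieldD(1)[OF subfield_L] by simp
  then show ?thesis by (metis add_cancel_right_right)
qed

lemma D_1 [simp]: "D 1 = 0"
proof -
  have "D 1 = D 1 + D 1"
    using D_mult[of 1 1] is_subfieldD(2)[OF subfield_L] by simp
  then show ?thesis by (metis add_cancel_right_right)
qed

lemma D_sum: "(\<And>i. i \<in> A \<Longrightarrow> g i \<in> L) \<Longrightarrow> D (sum g A) = (\<Sum>i\<in>A. D (g i))"
proof (induction A rule: infinite_finite_induct)
  case (insert i A)
  have "sum g A \<in> L"
    using insert.hyps(1) insert.prems
    by (induction A) (auto intro: is_subfieldD[OF subfield_L])
  with insert show ?case by (simp add: D_add)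
qed simp_all

lemma map_poly_D_add:
  "q \<in> coeffs_in L \<Longrightarrow> r \<in> coeffs_in L \<Longrightarrow> map_poly D (q + r) = map_poly D q + map_poly D r"
  by (intro poly_eqI) (simp add: coeff_map_poly D_add coeffs_inD)

lemma map_poly_D_mult:
  assumes "q \<in> coeffs_in L" "r \<in> coeffs_in L"
  shows "map_poly D (q * r) = map_poly D q * r + q * map_poly D r"
proof (rule poly_eqI)
  fix k
  have "D (Polynomial.coeff (q * r) k) =
        (\<Sum>i\<le>k. D (Polynomial.coeff q i * Polynomial.coeff r (k - i)))"
    unfolding coeff_mult
    by (rule D_sum) (auto intro!: is_subfieldD[OF subfield_L] coeffs_inD assms)
  also have "\<dots> = Polynomial.coeff (map_poly D q * r + q * map_poly D r) k"
    by (simp add: coeff_mult coeff_map_poly D_mult coeffs_inD assms sum.distrib)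
  finally show "Polynomial.coeff (map_poly D (q * r)) k =
                Polynomial.coeff (map_poly D q * r + q * map_poly D r) k"
    by (simp add: coeff_map_poly)
qed

lemma map_poly_D_pcompose:
  assumes "u \<in> coeffs_in L" "h \<in> coeffs_in L"
  shows "map_poly D (pcompose u h) =
         pcompose (map_poly D u) h + pcompose (pderiv u) h * map_poly D h"
  using assms(1)
proof (induction u)
  case (pCons a u)
  have uh: "h * pcompose u h \<in> coeffs_in L"
    using pCons.prems assms(2) by (auto intro!: coeffs_in_closed[OF subfield_L])
  have "map_poly D (pcompose (pCons a u) h) = [:D a:] + map_poly D (h * pcompose u h)"
    using pCons.prems uh
    by (simp add: pcompose_pCons map_poly_D_add map_poly_pCons coeffs_in_closed[OF subfield_L])
  also have "map_poly D (h * pcompose u h) =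
             map_poly D h * pcompose u h + h * map_poly D (pcompose u h)"
    using pCons.prems assms(2) by (intro map_poly_D_mult coeffs_in_closed[OF subfield_L]) auto
  finally show ?case
    using pCons by (simp add: pcompose_pCons pderiv_pCons map_poly_pCons pcompose_add algebra_simps)
qed simp

text \<open>
  Differentiating the coefficients of \<open>u \<circ> h\<close> gives \<open>(D u) \<circ> h = - (u' \<circ> h) \<cdot> D h\<close>.  Here the degree
  of \<open>h\<close> divides that of both compositions, hence that of \<open>D h\<close> if \<open>D h \<noteq> 0\<close>.  As \<open>h\<close> is monic,
  \<open>D h\<close> has smaller degree than \<open>h\<close>, so it is constant, and its constant term vanishes with that
  of \<open>h\<close>.
\<close>

lemma decomposition_rigid:
  assumes u: "u \<in> coeffs_in L" and h: "h \<in> coeffs_in L"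
    and Df: "map_poly D (pcompose u h) = 0"
    and sep: "pderiv u \<noteq> 0"
    and monic: "lead_coeff h = 1" and deg: "Polynomial.degree h > 0"
    and const: "Polynomial.coeff h 0 = 0"
  shows "map_poly D h = 0" "map_poly D u = 0"
proof -
  have eq: "pcompose (map_poly D u) h = - (pcompose (pderiv u) h * map_poly D h)"
    using map_poly_D_pcompose[OF u h] Df by (simp add: eq_neg_iff_add_eq_0)
  show Dh: "map_poly D h = 0"
  proof (rule ccontr)
    assume nz: "map_poly D h \<noteq> 0"
    have "pcompose (pderiv u) h \<noteq> 0"
      using sep deg by (simp add: pcompose_eq_0_iff)
    then have "Polynomial.degree (map_poly D u) * Polynomial.degree h =
               Polynomial.degree (pderiv u) * Polynomial.degree h + Polynomial.degree (map_poly D h)"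
      using arg_cong[OF eq, of Polynomial.degree] nz by (simp add: degree_pcompose degree_mult_eq)
    then have "Polynomial.degree h dvd Polynomial.degree (map_poly D h)"
      by (metis dvd_add_right_iff dvd_triv_right)
    moreover have "Polynomial.degree (map_poly D h) < Polynomial.degree h"
    proof (rule degree_lessI)
      show "\<forall>k\<ge>Polynomial.degree h. Polynomial.coeff (map_poly D h) k = 0"
        using monic by (auto simp: coeff_map_poly le_less coeff_eq_0)
    qed (use nz in simp)
    ultimately have "Polynomial.degree (map_poly D h) = 0"
      using nat_dvd_not_less by blast
    moreover have "Polynomial.coeff (map_poly D h) 0 = 0"
      by (simp add: coeff_map_poly const)
    ultimately show False
      using nz by (metis leading_coeff_0_iff)
  qed
  show "map_poly D u = 0"
    using eq Dh deg by (simp add: pcompose_eq_0_iff)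
qed

end

section \<open>The field generated by one p-th root\<close>

locale radical_step =
  fixes M :: "'a::field set" and c :: 'a and p :: nat
  assumes subfield: "is_subfield M"
    and char: "CHAR('a) = p" and prime: "prime p"
    and root: "c ^ p \<in> M" and new: "c \<notin> M"
begin

definition adjoin :: "'a set" where
  "adjoin = (\<lambda>q. poly q c) ` coeffs_in M"

lemma adjoinI: "q \<in> coeffs_in M \<Longrightarrow> poly q c \<in> adjoin"
  by (simp add: adjoin_def)

lemma base_subset_adjoin: "M \<subseteq> adjoin"
proof
  fix a assume "a \<in> M"
  then show "a \<in> adjoin"
    using adjoinI[of "[:a:]"] by (simp add: coeffs_in_closed[OF subfield])
qed

lemma generator_in_adjoin: "c \<in> adjoin"
  using adjoinI[of "[:0, 1:]"] by (simp add: coeffs_in_closed is_subfieldD subfield)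

lemma power_p_in_base: "q \<in> coeffs_in M \<Longrightarrow> poly q c ^ p \<in> M"
proof (induction q)
  case (pCons a q)
  have "poly (pCons a q) c ^ p = a ^ p + c ^ p * poly q c ^ p"
    using prime char by (simp add: freshmans_dream power_mult_distrib)
  with pCons root show ?case
    by (auto intro!: is_subfieldD[OF subfield])
qed (use prime_gt_0_nat[OF prime] in \<open>simp add: is_subfieldD[OF subfield] power_0_left\<close>)

text \<open>The inverse of \<open>x\<close> is \<open>x ^ (p - 1) / x ^ p\<close>, whose denominator lies in the base field.\<close>

lemma is_subfield_adjoin: "is_subfield adjoin"
proof -
  have mult: "x * y \<in> adjoin" if "x \<in> adjoin" "y \<in> adjoin" for x y
    using that unfolding adjoin_def
    by (auto intro!: image_eqI[where x = "_ * _"] coeffs_in_closed[OF subfield])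
  have one: "1 \<in> adjoin"
    using base_subset_adjoin is_subfieldD(2)[OF subfield] by blast
  have power: "x ^ k \<in> adjoin" if "x \<in> adjoin" for x k
    using that by (induction k) (auto intro: mult one)
  have inverse: "inverse x \<in> adjoin" if x: "x \<in> adjoin" for x
  proof -
    have "inverse (x ^ p) \<in> adjoin"
      using x power_p_in_base base_subset_adjoin is_subfieldD(6)[OF subfield]
      by (auto simp: adjoin_def)
    then have "x ^ (p - 1) * inverse (x ^ p) \<in> adjoin"
      by (intro mult power x)
    moreover have "x ^ (p - 1) * inverse (x ^ p) = inverse x"
      using prime_gt_0_nat[OF prime] by (cases "x = 0"; cases p) (auto simp: field_simps)
    ultimately show ?thesis by simp
  qed
  have "x + y \<in> adjoin" if "x \<in> adjoin" "y \<in> adjoin" for x y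
    using that unfolding adjoin_def
    by (auto intro!: image_eqI[where x = "_ + _"] coeffs_in_closed[OF subfield])
  moreover have "- x \<in> adjoin" if "x \<in> adjoin" for x
    using mult[of "-1" x] that base_subset_adjoin is_subfieldD(2,5)[OF subfield] by auto
  ultimately show ?thesis
    using mult one inverse base_subset_adjoin is_subfieldD(1)[OF subfield]
    by (auto simp: is_subfield_def)
qed

text \<open>Since \<open>g(c) \<noteq> 0\<close>, each factor \<open>X - c\<close> of the power divides the cofactor of \<open>g\<close>.\<close>

lemma dvd_linear_power_imp_const:
  fixes g :: "'a poly"
  assumes "g dvd [:-c, 1:] ^ k" "poly g c \<noteq> 0"
  shows "Polynomial.degree g = 0"
  using assms(1)
proof (induction k)
  case (Suc k)
  then obtain r where r: "[:-c, 1:] * [:-c, 1:] ^ k = g * r"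
    by (auto simp: dvd_def)
  then have "poly g c * poly r c = 0"
    by (metis poly_mult poly_eq_0_iff_dvd dvd_triv_left)
  then obtain s where "r = [:-c, 1:] * s"
    using assms(2) by (auto simp: poly_eq_0_iff_dvd dvd_def)
  then have "[:-c, 1:] * [:-c, 1:] ^ k = [:-c, 1:] * (g * s)"
    using r by (simp only: mult.left_commute)
  then have "[:-c, 1:] ^ k = g * s"
    by (subst (asm) mult_left_cancel) auto
  with Suc.IH show ?case by simp
qed (auto simp: is_unit_poly_iff)

text \<open>
  The minimal polynomial of \<open>c\<close> divides \<open>X ^ p - c ^ p = (X - c) ^ p\<close>.  Were \<open>c\<close> a simple root, it
  would be a multiple of \<open>X - c\<close> by a constant and \<open>c\<close> would lie in the base field.
\<close>

lemma minimal_polynomial: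
  "\<exists>m. m \<in> coeffs_in M \<and> poly m c = 0 \<and> poly (pderiv m) c = 0 \<and>
       Polynomial.degree m \<le> p \<and> m \<noteq> 0 \<and>
       (\<forall>q\<in>coeffs_in M. poly q c = 0 \<longrightarrow> m dvd q)"
proof -
  define P where "P = (\<lambda>q. q \<in> coeffs_in M \<and> q \<noteq> 0 \<and> poly q c = 0)"
  define b where "b = monom 1 p - [:c ^ p:]"
  have b_factor: "b = [:-c, 1:] ^ p"
  proof -
    have "[:0, 1:] ^ p = ([:-c, 1:] + [:c:]) ^ p" by simp
    also have "\<dots> = [:-c, 1:] ^ p + [:c:] ^ p"
      by (rule freshmans_dream) (use char prime in auto)
    finally show ?thesis
      by (simp add: b_def monom_altdef poly_const_pow)
  qed
  have "b \<in> coeffs_in M"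
    unfolding b_def using root
    by (auto intro!: coeffs_in_closed[OF subfield] is_subfieldD[OF subfield])
  moreover have "b \<noteq> 0" "poly b c = 0"
    using prime_gt_0_nat[OF prime] by (auto simp: b_factor)
  ultimately have "P b"
    by (simp add: P_def)
  define m where "m = arg_min Polynomial.degree P"
  have m: "P m" and min: "\<And>q. P q \<Longrightarrow> Polynomial.degree m \<le> Polynomial.degree q"
    using arg_min_nat_lemma[of P b Polynomial.degree] \<open>P b\<close> by (auto simp: m_def)
  have dvd: "m dvd q" if q: "q \<in> coeffs_in M" "poly q c = 0" for q
  proof (rule ccontr)
    assume "\<not> m dvd q"
    then have nz: "q mod m \<noteq> 0" by (simp add: dvd_eq_mod_eq_0)
    have "q mod m = q - m * (q div m)"
      by (simp add: minus_mult_div_eq_mod)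
    then have "poly (q mod m) c = 0"
      using q m by (simp add: P_def)
    then have "P (q mod m)"
      using nz q m coeffs_in_mod[OF subfield] by (simp add: P_def)
    with min[of "q mod m"] show False
      using degree_mod_less'[OF _ nz] m by (simp add: P_def)
  qed
  have "poly (pderiv m) c = 0"
  proof (rule ccontr)
    assume nz: "poly (pderiv m) c \<noteq> 0"
    obtain g where g: "m = [:-c, 1:] * g"
      using m by (auto simp: P_def poly_eq_0_iff_dvd)
    have "poly g c \<noteq> 0"
      using nz unfolding g pderiv_mult by (auto simp: pderiv_pCons)
    moreover have "g dvd [:-c, 1:] ^ p"
      using dvd[of b] \<open>P b\<close> g by (metis P_def b_factor dvd_mult_right)
    ultimately obtain a where a: "g = [:a:]" "a \<noteq> 0"
      using dvd_linear_power_imp_const by (metis degree_eq_zeroE poly_0 poly_const_conv)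
    then have "- (c * a) \<in> M" "a \<in> M"
      using m by (auto simp: P_def g mult.commute)
    then have "- (- (c * a) / a) \<in> M"
      by (rule is_subfieldD(5)[OF subfield, OF is_subfieldD(8)[OF subfield]])
    with a new show False by simp
  qed
  moreover have "Polynomial.degree m \<le> p"
    using min[OF \<open>P b\<close>] degree_linear_power[of "-c" p] by (simp add: b_factor)
  ultimately show ?thesis
    using m dvd by (intro exI[of _ m]) (auto simp: P_def)
qed

text \<open>
  Both the minimal polynomial and its derivative vanish at \<open>c\<close>, hence so does the derivative of
  every multiple of it, such as \<open>q - r\<close>.
\<close>

lemma pderiv_at_generator_eq:
  assumes "q \<in> coeffs_in M" "r \<in> coeffs_in M" "poly q c = poly r c"
  shows "poly (pderiv q) c = poly (pderiv r) c"
proof -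
  obtain m where m: "m \<in> coeffs_in M" "poly m c = 0" "poly (pderiv m) c = 0"
    "Polynomial.degree m \<le> p" "m \<noteq> 0"
    "\<forall>q\<in>coeffs_in M. poly q c = 0 \<longrightarrow> m dvd q"
    using minimal_polynomial by blast
  have "m dvd q - r"
    using assms by (intro m(6)[rule_format] coeffs_in_closed[OF subfield]) auto
  then obtain s where "q - r = m * s" by (auto simp: dvd_def)
  then have "poly (pderiv q - pderiv r) c = 0"
    using m(2,3) by (simp add: pderiv_diff[symmetric] pderiv_mult)
  then show ?thesis by simp
qed

text \<open>The derivation \<open>d/dc\<close> of the extension; the choice of \<open>q\<close> is immaterial by
  \<open>pderiv_at_generator_eq\<close>.\<close>

definition D :: "'a \<Rightarrow> 'a" where
  "D a = poly (pderiv (SOME q. q \<in> coeffs_in M \<and> poly q c = a)) c"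

lemma D_poly: "q \<in> coeffs_in M \<Longrightarrow> D (poly q c) = poly (pderiv q) c"
  unfolding D_def
  by (rule pderiv_at_generator_eq; (rule someI2_ex[of "\<lambda>r. r \<in> coeffs_in M \<and> poly r c = poly q c"])?) auto

lemma D_base: "a \<in> M \<Longrightarrow> D a = 0"
  using D_poly[of "[:a:]"] by (simp add: coeffs_in_closed[OF subfield])

sublocale subfield_derivation adjoin D
proof
  fix x y assume "x \<in> adjoin" "y \<in> adjoin"
  then obtain q r where q: "q \<in> coeffs_in M" "x = poly q c" and r: "r \<in> coeffs_in M" "y = poly r c"
    by (auto simp: adjoin_def)
  show "D (x + y) = D x + D y"
    using D_poly[of "q + r"] D_poly[of q] D_poly[of r] q r
    by (simp add: coeffs_in_closed[OF subfield] pderiv_add)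
  show "D (x * y) = D x * y + x * D y"
    using D_poly[of "q * r"] D_poly[of q] D_poly[of r] q r
    by (simp add: coeffs_in_closed[OF subfield] pderiv_mult algebra_simps)
qed (rule is_subfield_adjoin)

text \<open>
  Write \<open>a = r(c)\<close> with \<open>r\<close> of smaller degree than the minimal polynomial.  Then \<open>r'(c) = 0\<close> forces
  \<open>r' = 0\<close>, and since the degree of \<open>r\<close> is less than \<open>p\<close>, \<open>r\<close> is constant.
\<close>

lemma D_eq_0_imp_base:
  assumes "a \<in> adjoin" "D a = 0"
  shows "a \<in> M"
proof -
  obtain q where q: "q \<in> coeffs_in M" "a = poly q c"
    using assms(1) by (auto simp: adjoin_def)
  obtain m where m: "m \<in> coeffs_in M" "poly m c = 0" "poly (pderiv m) c = 0"
    "Polynomial.degree m \<le> p" "m \<noteq> 0"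
    "\<forall>q\<in>coeffs_in M. poly q c = 0 \<longrightarrow> m dvd q"
    using minimal_polynomial by blast
  define r where "r = q mod m"
  have r: "r \<in> coeffs_in M"
    using coeffs_in_mod[OF subfield m(1) q(1)] by (simp add: r_def)
  have "r = q - m * (q div m)"
    by (simp add: r_def minus_mult_div_eq_mod)
  then have a: "a = poly r c"
    using m(2) q(2) by simp
  have deg_m: "Polynomial.degree m > 0"
    using m(2,5) by (auto intro!: gr0I elim!: degree_eq_zeroE)
  then have deg: "Polynomial.degree r < Polynomial.degree m"
    using degree_mod_less[of m q] m(5) by (auto simp: r_def)
  have "pderiv r = 0"
  proof (rule ccontr)
    assume nz: "pderiv r \<noteq> 0"
    have "m dvd pderiv r"
      by (rule m(6)[rule_format]) (use coeffs_in_pderiv[OF subfield r] assms(2) D_poly[OF r] a in simp_all)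
    then have "Polynomial.degree m \<le> Polynomial.degree (pderiv r)"
      using nz by (rule dvd_imp_degree_le)
    also have "\<dots> \<le> Polynomial.degree r"
      by (rule degree_le) (simp add: coeff_pderiv coeff_eq_0)
    finally show False using deg by simp
  qed
  have "Polynomial.coeff r (Suc i) = 0" for i
  proof (cases "Suc i < p")
    case True
    have "(of_nat (Suc i) :: 'a) \<noteq> 0"
      using True char by (auto simp: of_nat_eq_0_iff_char_dvd dest: dvd_imp_le simp del: of_nat_Suc)
    then show ?thesis
      using arg_cong[OF \<open>pderiv r = 0\<close>, of "\<lambda>q. Polynomial.coeff q i"]
      by (simp add: coeff_pderiv del: of_nat_Suc)
  next
    case False
    then show ?thesis using deg m(4) by (intro coeff_eq_0) simp
  qed
  then have "r = [:Polynomial.coeff r 0:]"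
    by (intro poly_eqI) (simp add: coeff_pCons split: nat.splits)
  then have "a = Polynomial.coeff r 0"
    using a by (metis poly_const_conv)
  then show ?thesis using coeffs_inD[OF r] by simp
qed

lemma decomposition_descends:
  assumes "u \<in> coeffs_in adjoin" "h \<in> coeffs_in adjoin" "pcompose u h \<in> coeffs_in M"
    and "pderiv u \<noteq> 0" "lead_coeff h = 1" "Polynomial.degree h > 0" "Polynomial.coeff h 0 = 0"
  shows "u \<in> coeffs_in M" "h \<in> coeffs_in M"
proof -
  have "map_poly D (pcompose u h) = 0"
    using assms(3) by (intro poly_eqI) (simp add: coeff_map_poly D_base coeffs_inD)
  note rigid = decomposition_rigid[OF assms(1,2) this assms(4-7)]
  have "q \<in> coeffs_in M" if "q \<in> coeffs_in adjoin" "map_poly D q = 0" for q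
  proof (rule coeffs_inI)
    fix i
    have "D (Polynomial.coeff q i) = 0"
      using arg_cong[OF that(2), of "\<lambda>r. Polynomial.coeff r i"] by (simp add: coeff_map_poly)
    then show "Polynomial.coeff q i \<in> M"
      using that(1) D_eq_0_imp_base coeffs_inD by blast
  qed
  with rigid assms(1,2) show "u \<in> coeffs_in M" "h \<in> coeffs_in M"
    by blast+
qed

end

section \<open>Purely inseparable extensions\<close>

text \<open>
  Admitting only proper steps makes every step of a tower an instance of \<open>radical_step\<close>.
\<close>

inductive radical_tower :: "nat \<Rightarrow> 'a::field set \<Rightarrow> 'a set \<Rightarrow> bool" for p K where
  base: "radical_tower p K K"
| step: "radical_tower p K M \<Longrightarrow> c ^ p \<in> M \<Longrightarrow> c \<notin> M \<Longrightarrow>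
         radical_tower p K (radical_step.adjoin M c)"

context
  fixes K :: "'a::field set" and p :: nat
  assumes K: "is_subfield K" and char: "CHAR('a) = p" and prime: "prime p"
begin

lemma radical_tower_subfield: "radical_tower p K M \<Longrightarrow> is_subfield M \<and> K \<subseteq> M"
proof (induction rule: radical_tower.induct)
  case (step M c)
  then interpret radical_step M c p
    using char prime by unfold_locales auto
  show ?case
    using is_subfield_adjoin base_subset_adjoin step.IH by blast
qed (use K in simp)

lemma radical_tower_extend_step:
  assumes "radical_tower p K M" "c ^ p \<in> M"
  obtains M' where "radical_tower p K M'" "M \<subseteq> M'" "c \<in> M'"
proof (cases "c \<in> M")
  case False
  interpret radical_step M c p
    using assms False radical_tower_subfield char prime by unfold_locales auto
  show ?thesis
    using that radical_tower.step[OF assms False] base_subset_adjoin generator_in_adjoin by blast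
qed (use that assms in blast)

text \<open>Adjoin \<open>a ^ p ^ (e - 1)\<close>, then \<open>a ^ p ^ (e - 2)\<close>, and so on down to \<open>a\<close>.\<close>

lemma radical_tower_extend:
  assumes "radical_tower p K M" "a ^ (p ^ e) \<in> M"
  shows "\<exists>M'. radical_tower p K M' \<and> M \<subseteq> M' \<and> a \<in> M'"
  using assms
proof (induction e arbitrary: M)
  case (Suc e)
  have "(a ^ (p ^ e)) ^ p \<in> M"
    using Suc.prems(2) by (simp add: mult.commute flip: power_mult)
  then obtain M1 where "radical_tower p K M1" "M \<subseteq> M1" "a ^ (p ^ e) \<in> M1"
    using radical_tower_extend_step Suc.prems(1) by blast
  with Suc.IH[of M1] show ?case by blast
qed auto

lemma radical_tower_covers_finite:
  assumes insep: "purely_inseparable p K" and "finite S"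
  shows "\<exists>M. radical_tower p K M \<and> S \<subseteq> M"
  using assms(2)
proof (induction S)
  case empty
  then show ?case using radical_tower.base by blast
next
  case (insert a S)
  obtain M where M: "radical_tower p K M" "S \<subseteq> M"
    using insert.IH by blast
  obtain e where "a ^ (p ^ e) \<in> K"
    using insep by (auto simp: purely_inseparable_def)
  then have "a ^ (p ^ e) \<in> M"
    using radical_tower_subfield[OF M(1)] by blast
  with M(1) obtain M' where "radical_tower p K M'" "M \<subseteq> M'" "a \<in> M'"
    using radical_tower_extend by blast
  with M(2) show ?case by blast
qed

text \<open>
  The finitely many coefficients of \<open>u\<close> and \<open>h\<close> lie in one tower over \<open>K\<close>.  At each of its steps
  the composition has coefficients in the smaller field, as it has them in \<open>K\<close>, so
  \<open>decomposition_descends\<close> applies.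
\<close>

lemma decomposition_descends_purely_inseparable:
  assumes insep: "purely_inseparable p K"
    and f: "pcompose u h \<in> coeffs_in K"
    and norm: "pderiv u \<noteq> 0" "lead_coeff h = 1" "Polynomial.degree h > 0" "Polynomial.coeff h 0 = 0"
  shows "u \<in> coeffs_in K" "h \<in> coeffs_in K"
proof -
  have descend: "u \<in> coeffs_in K \<and> h \<in> coeffs_in K"
    if "radical_tower p K M" "u \<in> coeffs_in M" "h \<in> coeffs_in M" for M
    using that
  proof (induction rule: radical_tower.induct)
    case (step M c)
    interpret radical_step M c p
      using step radical_tower_subfield char prime by unfold_locales auto
    have "pcompose u h \<in> coeffs_in M"
      using f radical_tower_subfield[OF step.hyps(1)] coeffs_in_mono by blast
    then show ?case
      using decomposition_descends[OF step.prems _ norm] step.IH by blast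
  qed simp
  obtain M where M: "radical_tower p K M"
    "range (Polynomial.coeff u) \<union> range (Polynomial.coeff h) \<subseteq> M"
    using radical_tower_covers_finite[OF insep, of "range (Polynomial.coeff u) \<union> range (Polynomial.coeff h)"]
    by (auto simp: range_coeff)
  then have "u \<in> coeffs_in M" "h \<in> coeffs_in M"
    by (auto intro!: coeffs_inI)
  with descend M(1) show "u \<in> coeffs_in K" "h \<in> coeffs_in K"
    by blast+
qed

end

section \<open>Separable part of a one-variable polynomial\<close>

lemma pcompose_monom: "pcompose (monom a k) q = smult a (q ^ k)"
  for q :: "'a::comm_ring_1 poly"
  by (induction k) (simp_all add: monom_0 monom_Suc pcompose_pCons)

text \<open>If \<open>j a\<^sub>j = 0\<close> for all \<open>j\<close>, only the coefficients \<open>a\<^sub>j\<close> with \<open>p\<close> dividing \<open>j\<close> can be nonzero.\<close>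

lemma pderiv_eq_0_imp_pcompose_monom:
  fixes u :: "'a::field poly"
  assumes char: "CHAR('a) = p" and "p > 0" and "pderiv u = 0"
  obtains w where "u = pcompose w (monom 1 p)"
proof
  define d where "d = Polynomial.degree u"
  define w where "w = (\<Sum>i\<le>d. monom (Polynomial.coeff u (p * i)) i)"
  have vanish: "Polynomial.coeff u j = 0" if "\<not> p dvd j" for j
  proof (cases j)
    case (Suc i)
    have "of_nat (Suc i) * Polynomial.coeff u (Suc i) = 0"
      using arg_cong[OF \<open>pderiv u = 0\<close>, of "\<lambda>q. Polynomial.coeff q i"]
      by (simp add: coeff_pderiv del: of_nat_Suc)
    moreover have "(of_nat (Suc i) :: 'a) \<noteq> 0"
      using that char Suc by (simp add: of_nat_eq_0_iff_char_dvd del: of_nat_Suc)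
    ultimately show ?thesis using Suc by simp
  qed (use that in simp)
  have w: "pcompose w (monom 1 p) = (\<Sum>i\<le>d. monom (Polynomial.coeff u (p * i)) (p * i))"
    by (simp add: w_def pcompose_sum pcompose_monom monom_power smult_monom mult.commute)
  show "u = pcompose w (monom 1 p)"
  proof (rule poly_eqI)
    fix j
    have "Polynomial.coeff (pcompose w (monom 1 p)) j =
          (\<Sum>i\<le>d. if p * i = j then Polynomial.coeff u j else 0)"
      unfolding w coeff_sum by (intro sum.cong) auto
    also have "\<dots> = Polynomial.coeff u j"
    proof (cases "p dvd j")
      case True
      then obtain i where i: "j = p * i" by blast
      have "Polynomial.coeff u j = 0" if "i > d"
      proof (rule coeff_eq_0)
        have "i \<le> j" using i \<open>p > 0\<close> by simp
        with that show "Polynomial.degree u < j" by (simp add: d_def)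
      qed
      then show ?thesis
        using \<open>p > 0\<close> by (cases "i \<le> d") (auto simp: i)
    next
      case False
      then have "p * i \<noteq> j" for i by auto
      then show ?thesis using vanish[OF False] by simp
    qed
    finally show "Polynomial.coeff u j = Polynomial.coeff (pcompose w (monom 1 p)) j" ..
  qed
qed

text \<open>Each time the derivative vanishes, \<open>X ^ p\<close> can be split off, which divides the degree by \<open>p\<close>.\<close>

lemma separable_part:
  fixes u :: "'a::field poly"
  assumes "CHAR('a) = p" "prime p" "Polynomial.degree u > 0"
  shows "\<exists>v k. u = pcompose v (monom 1 (p ^ k)) \<and> pderiv v \<noteq> 0"
  using assms(3)
proof (induction "Polynomial.degree u" arbitrary: u rule: less_induct)
  case less
  show ?case
  proof (cases "pderiv u = 0")
    case True
    then obtain w where w: "u = pcompose w (monom 1 p)"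
      using pderiv_eq_0_imp_pcompose_monom[OF assms(1) prime_gt_0_nat[OF assms(2)]] by blast
    then have deg: "Polynomial.degree u = Polynomial.degree w * p"
      by (simp add: degree_pcompose degree_monom_eq)
    then have "Polynomial.degree w > 0" "Polynomial.degree w < Polynomial.degree u"
      using less.prems prime_gt_1_nat[OF assms(2)] by (auto intro!: gr0I)
    then obtain v k where v: "w = pcompose v (monom 1 (p ^ k))" "pderiv v \<noteq> 0"
      using less.hyps by blast
    have "u = pcompose v (monom 1 (p ^ Suc k))"
      unfolding w v(1) pcompose_assoc[symmetric]
      by (simp add: pcompose_monom monom_power)
    with v(2) show ?thesis by blast
  next
    case False
    then have "u = pcompose u (monom 1 (p ^ 0)) \<and> pderiv u \<noteq> 0"
      by (simp add: monom_altdef)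
    then show ?thesis by blast
  qed
qed

section \<open>Multivariate polynomials\<close>

lemma poly_mapping_additive_induct [case_names zero add]:
  fixes P :: "'b \<Rightarrow>\<^sub>0 'a::comm_monoid_add"
  assumes "Q 0" "\<And>m a P. Q P \<Longrightarrow> Q (Poly_Mapping.single m a + P)"
  shows "Q P"
proof (induction P rule: Poly_Mapping.update_induct)
  case (update P m a)
  have "Poly_Mapping.update m a P = Poly_Mapping.single m a + P"
    using update.hyps(1)
    by (intro poly_mapping_eqI) (auto simp: lookup_update lookup_add lookup_single when_def in_keys_iff)
  with assms(2)[OF update.IH] show ?case by simp
qed (rule assms)

lemma CHAR_poly_mapping: "CHAR('b::monoid_add \<Rightarrow>\<^sub>0 'a::semiring_1) = CHAR('a)"
proof (rule CHAR_eqI)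
  fix k assume "of_nat k = (0 :: 'b \<Rightarrow>\<^sub>0 'a)"
  then have "(of_nat k :: 'a) = 0"
    by (metis lookup_of_nat lookup_zero when_simps(1))
  then show "CHAR('a) dvd k"
    by (simp add: of_nat_eq_0_iff_char_dvd)
qed (simp flip: single_of_nat)

lemma mconst_simps:
  fixes a b :: "'a::field"
  shows "mconst 0 = 0" "mconst 1 = 1"
    and "mconst (a + b) = mconst a + mconst b"
    and "mconst (a * b) = mconst a * mconst b"
    and "mconst (a ^ k) = mconst a ^ k"
proof -
  show "mconst 0 = 0" and one: "mconst 1 = 1" and "mconst (a + b) = mconst a + mconst b"
    by (simp_all add: mconst_def single_add)
  have mult: "mconst (a * b) = mconst a * mconst b" for a b :: 'a
    by (simp add: mconst_def mult_single)
  then show "mconst (a * b) = mconst a * mconst b" .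
  show "mconst (a ^ k) = mconst a ^ k"
    by (induction k) (simp_all add: one mult)
qed

lemma lookup_mconst_mult:
  fixes P :: "'a::field mpoly"
  shows "Poly_Mapping.lookup (mconst a * P) m = a * Poly_Mapping.lookup P m"
proof (induction P rule: poly_mapping_additive_induct)
  case (add l b P)
  then show ?case
    by (simp add: ring_distribs lookup_add mconst_def mult_single lookup_single when_def)
qed simp

lemma mpoly_subst_pCons: "mpoly_subst (pCons a u) H = mconst a + H * mpoly_subst u H"
  by (simp add: mpoly_subst_def map_poly_pCons mconst_simps)

lemma mpoly_subst_0 [simp]: "mpoly_subst 0 H = 0"
  by (simp add: mpoly_subst_def)

lemma mpoly_subst_monom: "mpoly_subst (monom 1 k) H = H ^ k"
  by (simp add: mpoly_subst_def map_poly_monom mconst_simps poly_monom)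

lemma mpoly_subst_mconst: "mpoly_subst u (mconst a) = mconst (poly u a)"
  by (induction u) (simp_all add: mpoly_subst_pCons mconst_simps)

lemma mpoly_subst_add: "mpoly_subst (u + v) H = mpoly_subst u H + mpoly_subst v H"
proof -
  have "map_poly mconst (u + v) = map_poly mconst u + map_poly mconst v"
    by (intro poly_eqI) (simp add: coeff_map_poly mconst_simps)
  then show ?thesis by (simp add: mpoly_subst_def)
qed

lemma mpoly_subst_mult: "mpoly_subst (u * v) H = mpoly_subst u H * mpoly_subst v H"
proof (induction u)
  case (pCons a u)
  have "mpoly_subst (smult a v) H = mconst a * mpoly_subst v H"
    by (induction v) (simp_all add: mpoly_subst_pCons mconst_simps algebra_simps)
  with pCons show ?case
    by (simp add: mpoly_subst_pCons mpoly_subst_add mconst_simps algebra_simps)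
qed simp

lemma mpoly_subst_pcompose: "mpoly_subst (pcompose u v) H = mpoly_subst u (mpoly_subst v H)"
  by (induction u)
    (simp_all add: pcompose_pCons mpoly_subst_pCons mpoly_subst_add mpoly_subst_mult mconst_simps)

lemma mpolys_UNIV_mult:
  fixes P Q :: "'a::field mpoly"
  assumes "P \<in> mpolys UNIV n" "Q \<in> mpolys UNIV n"
  shows "P * Q \<in> mpolys UNIV n"
proof -
  have "Poly_Mapping.keys m \<subseteq> {..<n}" if "m \<in> Poly_Mapping.keys (P * Q)" for m
  proof -
    obtain a b where "m = a + b" "a \<in> Poly_Mapping.keys P" "b \<in> Poly_Mapping.keys Q"
      using keys_mult[of P Q] \<open>m \<in> Poly_Mapping.keys (P * Q)\<close> by blast
    with assms keys_add[of a b] show ?thesis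
      by (fastforce simp: mpolys_def)
  qed
  then show ?thesis by (simp add: mpolys_def)
qed

lemma mpolys_UNIV_mconst: "mconst a \<in> mpolys UNIV n"
  by (auto simp: mpolys_def mconst_def)

lemma mpolys_UNIV_power: "P \<in> mpolys UNIV n \<Longrightarrow> P ^ k \<in> mpolys UNIV n"
  for P :: "'a::field mpoly"
proof (induction k)
  case 0
  then show ?case using mpolys_UNIV_mconst[of "1 :: 'a"] by (simp add: mconst_simps)
qed (simp add: mpolys_UNIV_mult)

lemma mpolys_UNIV_diff:
  fixes P Q :: "'a::field mpoly"
  assumes "P \<in> mpolys UNIV n" "Q \<in> mpolys UNIV n"
  shows "P - Q \<in> mpolys UNIV n"
  using assms keys_diff[of P Q] unfolding mpolys_def by blast

section \<open>Kronecker substitution\<close>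

text \<open>The exponent of the power of \<open>X\<close> to which \<open>x\<^sub>i \<mapsto> X ^ N ^ i\<close> sends a monomial.\<close>

definition weight :: "nat \<Rightarrow> (nat \<Rightarrow>\<^sub>0 nat) \<Rightarrow> nat" where
  "weight N m = (\<Sum>i\<in>Poly_Mapping.keys m. Poly_Mapping.lookup m i * N ^ i)"

lemma weight_add: "weight N (a + b) = weight N a + weight N b"
  unfolding weight_def
  by (rule setsum_keys_plus_distrib[of "\<lambda>i e. e * N ^ i"]) (simp_all add: algebra_simps)

lemma weight_0 [simp]: "weight N 0 = 0"
  by (simp add: weight_def)

text \<open>
  Two different monomials have the same weight only if \<open>N\<close> is a root of the nonzero integer
  polynomial whose coefficients are the differences of their exponents.
\<close>

lemma ex_weight_inj_on:
  assumes "finite S"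
  shows "\<exists>N. inj_on (weight N) S"
proof -
  define digits where
    "digits m = (\<Sum>i\<in>Poly_Mapping.keys m. monom (int (Poly_Mapping.lookup m i)) i)" for m
  have coeff: "Polynomial.coeff (digits m) i = int (Poly_Mapping.lookup m i)" for m i
    by (simp add: digits_def coeff_sum in_keys_iff)
  have eval: "poly (digits m) (int N) = int (weight N m)" for m N
    by (simp add: digits_def weight_def poly_sum poly_monom)
  have inj: "m = m'" if "digits m = digits m'" for m m'
    using arg_cong[OF that, of "\<lambda>q. Polynomial.coeff q _"] coeff
    by (metis poly_mapping_eqI of_nat_eq_iff)
  define bad where
    "bad = (\<Union>(m, m')\<in>{(m, m') \<in> S \<times> S. m \<noteq> m'}. {x. poly (digits m - digits m') x = 0})"
  have "finite bad"
    unfolding bad_def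
  proof (intro finite_UN_I)
    show "finite {(m, m') \<in> S \<times> S. m \<noteq> m'}"
      by (rule finite_subset[of _ "S \<times> S"]) (use assms in auto)
  next
    fix z assume "z \<in> {(m, m') \<in> S \<times> S. m \<noteq> m'}"
    then show "finite (case z of (m, m') \<Rightarrow> {x. poly (digits m - digits m') x = 0})"
      using inj by (auto intro!: poly_roots_finite simp del: poly_diff)
  qed
  moreover have "infinite (range int)"
    using finite_imageD[OF _ inj_of_nat] by blast
  ultimately obtain N where N: "int N \<notin> bad"
    by (meson finite_subset image_subsetI)
  have "inj_on (weight N) S"
  proof (rule inj_onI, rule ccontr)
    fix m m' assume "m \<in> S" "m' \<in> S" "weight N m = weight N m'" "m \<noteq> m'"
    then have "int N \<in> bad"
      by (auto simp: bad_def eval)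
    with N show False by simp
  qed
  then show ?thesis ..
qed

text \<open>
  Given by its effect on each term; that it is the ring homomorphism \<open>x\<^sub>i \<mapsto> X ^ N ^ i\<close> comes from
  the additivity of the weight.
\<close>

definition kronecker :: "nat \<Rightarrow> 'a::field mpoly \<Rightarrow> 'a poly" where
  "kronecker N P = (\<Sum>m\<in>Poly_Mapping.keys P. monom (Poly_Mapping.lookup P m) (weight N m))"

lemma kronecker_0 [simp]: "kronecker N 0 = 0"
  by (simp add: kronecker_def)

lemma kronecker_add: "kronecker N (P + Q) = kronecker N P + kronecker N Q"
  unfolding kronecker_def
  by (rule setsum_keys_plus_distrib[of "\<lambda>m a. monom a (weight N m)"]) (simp_all add: add_monom)

lemma kronecker_single: "kronecker N (Poly_Mapping.single m a) = monom a (weight N m)"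
  by (simp add: kronecker_def)

lemma kronecker_mconst: "kronecker N (mconst a) = [:a:]"
  by (simp add: mconst_def kronecker_single monom_0)

lemma kronecker_mult: "kronecker N (P * Q) = kronecker N P * kronecker N Q"
proof (induction P rule: poly_mapping_additive_induct)
  case (add m a P)
  have "kronecker N (Poly_Mapping.single m a * Q) = monom a (weight N m) * kronecker N Q"
  proof (induction Q rule: poly_mapping_additive_induct)
    case (add l b Q)
    then show ?case
      by (simp add: ring_distribs kronecker_add kronecker_single mult_single mult_monom weight_add)
  qed simp
  with add show ?case
    by (simp add: ring_distribs kronecker_add kronecker_single)
qed simp

lemma kronecker_power: "kronecker N (P ^ k) = kronecker N P ^ k"
proof (induction k)
  case 0
  then show ?case using kronecker_mconst[of N 1] by (simp add: mconst_simps one_pCons)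
qed (simp add: kronecker_mult)

lemma kronecker_mpoly_subst: "kronecker N (mpoly_subst u H) = pcompose u (kronecker N H)"
  by (induction u)
    (simp_all add: mpoly_subst_pCons pcompose_pCons kronecker_add kronecker_mult kronecker_mconst)

lemma coeff_kronecker_weight:
  assumes "inj_on (weight N) S" "Poly_Mapping.keys P \<subseteq> S" "m \<in> S"
  shows "Polynomial.coeff (kronecker N P) (weight N m) = Poly_Mapping.lookup P m"
proof -
  have "Polynomial.coeff (kronecker N P) (weight N m) =
        (\<Sum>l\<in>Poly_Mapping.keys P. if l = m then Poly_Mapping.lookup P l else 0)"
    unfolding kronecker_def coeff_sum
    using assms by (intro sum.cong) (auto dest: inj_onD)
  also have "\<dots> = Poly_Mapping.lookup P m"
    by (simp add: in_keys_iff)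
  finally show ?thesis .
qed

lemma kronecker_coeffs_in:
  assumes "is_subfield K" "P \<in> mpolys K n"
  shows "kronecker N P \<in> coeffs_in K"
proof -
  have "sum g A \<in> coeffs_in K" if "\<And>m. m \<in> A \<Longrightarrow> g m \<in> coeffs_in K"
    for A :: "(nat \<Rightarrow>\<^sub>0 nat) set" and g
    using that
    by (induction A rule: infinite_finite_induct) (auto intro: coeffs_in_closed[OF assms(1)])
  then show ?thesis
    unfolding kronecker_def
    using assms by (simp add: mpolys_def coeffs_in_closed(7))
qed

section \<open>Indecomposability over a purely inseparable extension\<close>

text \<open>
  Under a Kronecker substitution separating the monomials of \<open>H ^ q\<close>, where \<open>q = p ^ k\<close>, the image \<open>h\<close>
  of \<open>H\<close> has a leading coefficient \<open>a\<close> and a constant term \<open>b\<close>.  Normalising \<open>H\<close> to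
  \<open>H\<^sub>1 = (H - b) / a\<close> changes \<open>H ^ q\<close> to \<open>(H ^ q - b ^ q) / a ^ q\<close>, since \<open>q\<close>-th powers are additive:
  so the inner polynomial is normalised too, it is still a \<open>q\<close>-th power, and it acquires no monomial
  except possibly the constant one.  The image of the new decomposition has coefficients in \<open>K\<close> by
  rigidity, and the coefficients of \<open>H\<^sub>1 ^ q\<close> can be read off from its image.
\<close>

lemma normalised_decomposition_descends:
  fixes K :: "'a::field set" and F H :: "'a mpoly"
  assumes K: "is_subfield K" and char: "CHAR('a) = p" and prime: "prime p"
    and insep: "purely_inseparable p K"
    and F: "F \<in> mpolys K n" "F \<notin> range mconst"
    and H: "H \<in> mpolys UNIV n" and dec: "F = mpoly_subst v (H ^ p ^ k)" and sep: "pderiv v \<noteq> 0"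
  obtains w H1 where "F = mpoly_subst w (H1 ^ p ^ k)" "w \<in> coeffs_in K" "H1 \<in> mpolys UNIV n"
    "H1 ^ p ^ k \<in> mpolys K n" "Polynomial.degree w = Polynomial.degree v"
proof -
  define q where "q = p ^ k"
  have q: "q > 0" using prime_gt_0_nat[OF prime] by (simp add: q_def)
  \<comment> \<open>Including \<open>0\<close> keeps the other monomials of \<open>H ^ q\<close> away from the constant term of the image.\<close>
  define S where "S = insert 0 (Poly_Mapping.keys (H ^ q))"
  obtain N where N: "inj_on (weight N) S"
    using ex_weight_inj_on[of S] by (auto simp: S_def)
  define h where "h = kronecker N H"
  have deg_h: "Polynomial.degree h > 0"
  proof (rule gr0I)
    assume "Polynomial.degree h = 0"
    then obtain a where "h = [:a:]" by (rule degree_eq_zeroE)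
    then have const: "kronecker N (H ^ q) = [:a ^ q:]"
      by (simp add: kronecker_power h_def poly_const_pow)
    have "Poly_Mapping.lookup (H ^ q) m = 0" if "m \<noteq> 0" for m
    proof (cases "m \<in> S")
      case True
      with N that have "weight N m \<noteq> 0"
        by (metis S_def inj_onD insertI1 weight_0)
      then have "Polynomial.coeff (kronecker N (H ^ q)) (weight N m) = 0"
        by (simp add: const coeff_pCons split: nat.splits)
      then show ?thesis
        using coeff_kronecker_weight[OF N _ True, of "H ^ q"] by (auto simp: S_def)
    qed (simp add: S_def in_keys_iff)
    then have "H ^ q = mconst (Poly_Mapping.lookup (H ^ q) 0)"
      by (intro poly_mapping_eqI) (auto simp: mconst_def lookup_single when_def)
    then have "F \<in> range mconst"
      using dec unfolding q_def by (metis mpoly_subst_mconst rangeI)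
    with F show False by simp
  qed
  define a where "a = lead_coeff h"
  define b where "b = Polynomial.coeff h 0"
  have a: "a \<noteq> 0" using deg_h by (auto simp: a_def)
  define H1 where "H1 = mconst (1 / a) * (H - mconst b)"
  have H_eq: "H = mconst a * H1 + mconst b"
    using a by (simp add: H1_def mult.assoc[symmetric] flip: mconst_simps(4))
      (simp add: mconst_simps)
  define h1 where "h1 = kronecker N H1"
  have h_eq: "h = smult a h1 + [:b:]"
    unfolding h_def h1_def
    by (subst H_eq) (simp add: kronecker_add kronecker_mult kronecker_mconst)
  have deg_h1: "Polynomial.degree h1 = Polynomial.degree h"
  proof -
    have "smult a h1 = h - [:b:]" using h_eq by simp
    moreover have "Polynomial.degree (h - [:b:]) = Polynomial.degree h"
      unfolding diff_conv_add_uminus using deg_h by (intro degree_add_eq_left) simp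
    ultimately show ?thesis using a by (metis degree_smult_eq)
  qed
  have monic: "lead_coeff h1 = 1"
  proof -
    have "Polynomial.coeff h (Polynomial.degree h) = a * Polynomial.coeff h1 (Polynomial.degree h)"
      using deg_h by (subst h_eq) (simp add: coeff_pCons split: nat.splits)
    then show ?thesis using a by (simp add: a_def deg_h1)
  qed
  have const: "Polynomial.coeff h1 0 = 0"
    using arg_cong[OF h_eq, of "\<lambda>r. Polynomial.coeff r 0"] a by (simp add: b_def)
  have Hq: "H ^ q = mconst (a ^ q) * H1 ^ q + mconst (b ^ q)"
  proof -
    have "H ^ q = (mconst a * H1) ^ q + mconst b ^ q"
      by (subst H_eq, rule freshmans_dream')
        (use char prime in \<open>simp_all add: CHAR_poly_mapping q_def\<close>)
    then show ?thesis by (simp add: power_mult_distrib mconst_simps)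
  qed
  define w where "w = pcompose v [:b ^ q, a ^ q:]"
  have F_eq: "F = mpoly_subst w (H1 ^ q)"
    using dec unfolding w_def q_def[symmetric] Hq
    by (simp add: mpoly_subst_pcompose mpoly_subst_pCons algebra_simps)
  have "pcompose w (h1 ^ q) = kronecker N F"
    by (simp add: F_eq kronecker_mpoly_subst kronecker_power h1_def)
  then have "pcompose w (h1 ^ q) \<in> coeffs_in K"
    using kronecker_coeffs_in[OF K F(1)] by simp
  moreover have "pderiv w \<noteq> 0"
    using sep a by (auto simp: w_def pderiv_pcompose pderiv_pCons pcompose_eq_0_iff)
  moreover have "lead_coeff (h1 ^ q) = 1"
    using monic by (simp add: lead_coeff_power)
  moreover have "Polynomial.degree (h1 ^ q) > 0"
    using deg_h deg_h1 q by (subst degree_power_eq) auto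
  moreover have "Polynomial.coeff (h1 ^ q) 0 = 0"
    using const q by (simp add: coeff_0_power)
  ultimately have w: "w \<in> coeffs_in K" and h1: "h1 ^ q \<in> coeffs_in K"
    using decomposition_descends_purely_inseparable[OF K char prime insep] by blast+
  have "H1 \<in> mpolys UNIV n"
    unfolding H1_def by (intro mpolys_UNIV_mult mpolys_UNIV_diff mpolys_UNIV_mconst H)
  moreover have "H1 ^ q \<in> mpolys K n"
  proof -
    have keys: "Poly_Mapping.keys (H1 ^ q) \<subseteq> S"
    proof
      fix m assume m: "m \<in> Poly_Mapping.keys (H1 ^ q)"
      show "m \<in> S"
      proof (rule ccontr)
        assume "m \<notin> S"
        then have "Poly_Mapping.lookup (H ^ q) m = 0" "m \<noteq> 0"
          by (auto simp: S_def in_keys_iff)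
        then have "a ^ q * Poly_Mapping.lookup (H1 ^ q) m = 0"
          unfolding Hq lookup_add lookup_mconst_mult by (simp add: mconst_def lookup_single)
        with a m show False by (simp add: in_keys_iff)
      qed
    qed
    have "Poly_Mapping.lookup (H1 ^ q) m \<in> K" for m
    proof (cases "m \<in> S")
      case True
      then show ?thesis
        using coeff_kronecker_weight[OF N keys True] coeffs_inD[OF h1, of "weight N m"]
        by (simp add: kronecker_power h1_def)
    next
      case False
      then show ?thesis
        using keys is_subfieldD(1)[OF K] by (metis in_keys_iff subsetD)
    qed
    moreover have "H1 ^ q \<in> mpolys UNIV n"
      using \<open>H1 \<in> mpolys UNIV n\<close> by (rule mpolys_UNIV_power)
    ultimately show ?thesis by (simp add: mpolys_def)
  qed
  moreover have "Polynomial.degree w = Polynomial.degree v"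
    using a by (simp add: w_def degree_pcompose)
  ultimately show ?thesis
    using that F_eq w unfolding q_def by blast
qed

theorem proposition4p1:
  fixes K :: "'a::field set" and F :: "'a mpoly" and n p :: nat
  assumes "n \<ge> 2"
    and "is_subfield K"
    and "CHAR('a) = p" and "p > 0"
    and "purely_inseparable p K"
    and "F \<in> mpolys K n"
    and "\<not> (\<exists>G b c. G \<in> mpolys UNIV n \<and> b \<in> K \<and> c \<in> K \<and>
                  F = mconst b * G ^ p + mconst c)"
  shows "indecomposable K n F \<longleftrightarrow> indecomposable UNIV n F"
proof
  assume "indecomposable UNIV n F"
  moreover have "mpolys K n \<subseteq> mpolys UNIV n"
    by (auto simp: mpolys_def)
  ultimately show "indecomposable K n F"
    using assms(6) unfolding indecomposable_def by blast
next
  assume indec: "indecomposable K n F"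
  have prime: "prime p"
    using assms(3,4) prime_CHAR_semidom[where 'a = 'a] by simp
  show "indecomposable UNIV n F"
  proof (rule ccontr)
    assume "\<not> indecomposable UNIV n F"
    then obtain H u where H: "H \<in> mpolys UNIV n" and u: "Polynomial.degree u \<ge> 2"
      and F: "F = mpoly_subst u H"
      using indec by (auto simp: indecomposable_def mpolys_def)
    obtain v k where v: "u = pcompose v (monom 1 (p ^ k))" "pderiv v \<noteq> 0"
      using separable_part[OF assms(3) prime, of u] u by auto
    have "F = mpoly_subst v (H ^ p ^ k)"
      by (simp add: F v(1) mpoly_subst_pcompose mpoly_subst_monom)
    then obtain w H1 where F1: "F = mpoly_subst w (H1 ^ p ^ k)" and w: "w \<in> coeffs_in K"
      and H1: "H1 \<in> mpolys UNIV n" "H1 ^ p ^ k \<in> mpolys K n"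
      and deg_w: "Polynomial.degree w = Polynomial.degree v"
      using indec H v(2)
      by (rule_tac normalised_decomposition_descends[OF assms(2,3) prime assms(5,6)])
         (auto simp: indecomposable_def)
    have "Polynomial.degree w < 2"
      using indec F1 H1(2) w unfolding indecomposable_def coeffs_in_def by fastforce
    moreover have "Polynomial.degree v \<noteq> 0"
      using v(2) by (metis degree_eq_zeroE pderiv_singleton)
    ultimately have deg: "Polynomial.degree w = 1" "Polynomial.degree v = 1"
      using deg_w by auto
    then have "p ^ k \<ge> 2"
      using u by (simp add: v(1) degree_pcompose degree_monom_eq)
    then obtain j where j: "k = Suc j"
      by (cases k) auto
    obtain b c where bc: "w = [:c, b:]"
    proof
      show "w = [:Polynomial.coeff w 0, Polynomial.coeff w 1:]"
        using deg(1) by (intro poly_eqI) (auto simp: coeff_pCons coeff_eq_0 split: nat.splits)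
    qed
    have "F = mconst b * (H1 ^ p ^ j) ^ p + mconst c"
      by (simp add: F1 bc j mpoly_subst_pCons power_mult[symmetric] algebra_simps)
    moreover have "b \<in> K" "c \<in> K"
      using w by (auto simp: bc)
    ultimately show False
      using assms(7) mpolys_UNIV_power[OF H1(1)] by blast
  qed
qed

end
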